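(* Let $\mathbf{A}$ be an $n\times n$ real symmetric matrix, let $a\le\lambda_{\min}[\mathbf{A}]$ and $b\ge\lambda_{\max}[\mathbf{A}]$, and let $\mathbf{v}_1,\dots,\mathbf{v}_{n_{\mathrm{v}}}$ be unit vectors. Set $\Psi_i=\Psi[\mathbf{A},\mathbf{v}_i]$ and, for each $i$, let $[\theta_i]_1\le\cdots\le[\theta_i]_k$ be the eigenvalues of the $k\times k$ Lanczos tridiagonal matrix $\mathbf{T}_i$ obtained from $\mathbf{A},\mathbf{v}_i$, and $[d_i]_1,\dots,[d_i]_k$ the squares of the first components of the corresponding normalized eigenvectors, so that $\mathrm{GQ}_k(\Psi_i)(x)=\sum_{j=1}^k[d_i]_j\mathbb{1}[[\theta_i]_j\le x]$. Set $[\theta_i]_0=a$, $[\theta_i]_{k+1}=b$, $[d_i]_0=[d_i]_{k+1}=0$. Writing $\langle x_i\rangle=\frac1{n_{\mathrm{v}}}\sum_{i=1}^{n_{\mathrm{v}}}x_i$, we have $$d_{\mathrm{KS}}\big(\langle\Psi_i\rangle,\langle\mathrm{GQ}_k(\Psi_i)\rangle\big)\le\Big\langle\max_{j=1,\dots,k}[d_i]_j\Big\rangle,$$ $$d_{\mathrm{W}}\big(\langle\Psi_i\rangle,\langle\mathrm{GQ}_k(\Psi_i)\rangle\big)\le\Big\langle\sum_{j=0}^{k}\max\{[d_i]_j,[d_i]_{j+1}\}\big([\theta_i]_{j+1}-[\theta_i]_j\big)\Big\rangle.$$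
   Context: For a symmetric matrix $\mathbf{A}$, $\mathbb{1}[\mathbf{A}\le x]$ is the orthogonal projector onto the span of eigenvectors with eigenvalues $\le x$, and the weighted CESM of a unit vector $\mathbf{v}$ is $\Psi[\mathbf{A},\mathbf{v}](x)=\mathbf{v}^{\mathsf T}\mathbb{1}[\mathbf{A}\le x]\mathbf{v}$. $\mathrm{GQ}_k(\mu)$ denotes the $k$-point Gaussian quadrature rule of a distribution $\mu$: the distribution with $k$ atoms matching the moments of $\mu$ up to degree $2k-1$; for $\mu=\Psi[\mathbf{A},\mathbf{v}]$ it is given by the eigenvalues and squared first eigenvector components of the $k$-step Lanczos tridiagonal matrix as described. $d_{\mathrm{KS}}(\mu,\nu)=\sup_x|\mu(x)-\nu(x)|$ and $d_{\mathrm{W}}(\mu,\nu)=\int|\mu(x)-\nu(x)|\,dx$. *)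

theory Defs
  imports "HOL-Analysis.Analysis"
begin

text \<open>Eigenvectors of A with eigenvalue at most x (together with 0), and their span.\<close>
definition eigvecs_le :: "real^'n^'n \<Rightarrow> real \<Rightarrow> (real^'n) set" where
  "eigvecs_le A x = {u. \<exists>c. c \<le> x \<and> A *v u = c *\<^sub>R u}"

definition espace_le :: "real^'n^'n \<Rightarrow> real \<Rightarrow> (real^'n) set" where
  "espace_le A x = span (eigvecs_le A x)"

text \<open>Orthogonal projector 1[A <= x] applied to v.\<close>
definition spec_proj :: "real^'n^'n \<Rightarrow> real \<Rightarrow> real^'n \<Rightarrow> real^'n" where
  "spec_proj A x v = (THE w. w \<in> espace_le A x \<and> (\<forall>u\<in>espace_le A x. (v - w) \<bullet> u = 0))"

text \<open>Weighted CESM Psi[A,v](x) = v^T 1[A <= x] v.\<close>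
definition cesm :: "real^'n^'n \<Rightarrow> real^'n \<Rightarrow> real \<Rightarrow> real" where
  "cesm A v x = v \<bullet> spec_proj A x v"

text \<open>Distribution function of the atomic measure with nodes theta_1..theta_k, weights d_1..d_k.\<close>
definition atomic_cdf :: "nat \<Rightarrow> (nat \<Rightarrow> real) \<Rightarrow> (nat \<Rightarrow> real) \<Rightarrow> real \<Rightarrow> real" where
  "atomic_cdf k \<theta> d x = (\<Sum>j=1..k. d j * (if \<theta> j \<le> x then 1 else 0))"

text \<open>(theta,d) is the k-point Gaussian quadrature rule GQ_k(Psi[A,v]): k distinct atoms
  with positive weights whose moments of degree 0..2k-1 match those of Psi[A,v],
  i.e. v^T A^m v.\<close>
definition is_gauss_quad :: "nat \<Rightarrow> real^'n^'n \<Rightarrow> real^'n \<Rightarrow> (nat \<Rightarrow> real) \<Rightarrow> (nat \<Rightarrow> real) \<Rightarrow> bool" where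
  "is_gauss_quad k A v \<theta> d \<longleftrightarrow>
     (\<forall>j\<in>{1..<k}. \<theta> j < \<theta> (Suc j)) \<and> (\<forall>j\<in>{1..k}. d j > 0) \<and>
     (\<forall>m<2*k. (\<Sum>j=1..k. d j * \<theta> j ^ m) = v \<bullet> (((*v) A ^^ m) v))"

definition d_KS :: "(real \<Rightarrow> real) \<Rightarrow> (real \<Rightarrow> real) \<Rightarrow> ereal" where
  "d_KS \<mu> \<nu> = (SUP x. ereal \<bar>\<mu> x - \<nu> x\<bar>)"

definition d_W :: "(real \<Rightarrow> real) \<Rightarrow> (real \<Rightarrow> real) \<Rightarrow> ennreal" where
  "d_W \<mu> \<nu> = (\<integral>\<^sup>+ x. ennreal \<bar>\<mu> x - \<nu> x\<bar> \<partial>lborel)"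

end

theory Submission
  imports Defs "HOL-Computational_Algebra.Polynomial"
begin

(* Diagonalising A writes Psi[A,v] as the distribution function of a finite measure on the
   eigenvalues of A, which lie in [a,b], with moments v^T A^m v; the Gaussian quadrature rule has
   positive weights d_j at nodes theta_1 < ... < theta_k and the same moments up to degree 2k - 1.
   By the Chebyshev-Markov-Stieltjes inequalities the measure of (-inf, theta_i] is at most
   d_1 + ... + d_i and that of [theta_i, inf) is at most d_i + ... + d_k, so on each gap
   [theta_j, theta_(j+1)) the two distribution functions differ by at most max(d_j, d_(j+1)).
   This is the Kolmogorov-Smirnov bound, integrating it gives the Wasserstein bound, and both
   survive averaging over the vectors.

   The first inequality tests the measure against the polynomial P of degree 2k - 2 that is 1 at
   theta_1, ..., theta_i, 0 at the later nodes, and stationary at every node except theta_i.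
   Rolle's theorem accounts for all 2k - 3 roots of P'; pairing each stationary node with the
   Rolle point to its right reads off the sign of P' everywhere, whence P dominates the indicator
   of (-inf, theta_i].  The second inequality is the first one for the reflected measure. *)

section \<open>Polynomials, finite sums and products\<close>

lemma poly_antimono_on:
  fixes p :: "real poly"
  assumes "s \<le> t" and "\<And>x. s < x \<Longrightarrow> x < t \<Longrightarrow> poly (pderiv p) x \<le> 0"
  shows "poly p t \<le> poly p s"
proof (cases "s = t")
  case False
  then obtain x where "s < x" "x < t" "poly p t - poly p s = (t - s) * poly (pderiv p) x"
    using poly_MVT[of s t p] assms(1) by auto
  moreover have "(t - s) * poly (pderiv p) x \<le> 0"
    using assms \<open>s < x\<close> \<open>x < t\<close> by (simp add: mult_nonneg_nonpos)
  ultimately show ?thesis by linarith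
qed simp

lemma poly_mono_on:
  fixes p :: "real poly"
  assumes "s \<le> t" and "\<And>x. s < x \<Longrightarrow> x < t \<Longrightarrow> 0 \<le> poly (pderiv p) x"
  shows "poly p s \<le> poly p t"
  using poly_antimono_on[of s t "- p"] assms by (simp add: pderiv_minus)

lemma pderiv_sum: "pderiv (\<Sum>x\<in>A. f x) = (\<Sum>x\<in>A. pderiv (f x))"
  using higher_pderiv_sum[of 1 f A] by simp

lemma poly_pderiv_mult_square:
  fixes p q :: "real poly"
  shows "poly (pderiv (q * p\<^sup>2)) x = poly (pderiv q) x * (poly p x)\<^sup>2 + 2 * poly q x * poly p x * poly (pderiv p) x"
  by (simp add: pderiv_mult pderiv_power power2_eq_square algebra_simps)

lemma degree_cancel_leading_coeff:
  fixes p q :: "'a::field poly"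
  assumes "degree p \<le> Suc n" and "degree q = Suc n"
  shows "degree (p - smult (coeff p (Suc n) / coeff q (Suc n)) q) \<le> n"
proof (rule degree_le, intro allI impI)
  fix j assume "n < j"
  have "q \<noteq> 0" using assms(2) by auto
  then have "coeff q (Suc n) \<noteq> 0" using assms(2) by (metis leading_coeff_0_iff)
  moreover have "Suc n < j \<Longrightarrow> coeff p j = 0 \<and> coeff q j = 0" using assms by (simp add: coeff_eq_0)
  ultimately show "coeff (p - smult (coeff p (Suc n) / coeff q (Suc n)) q) j = 0"
    using \<open>n < j\<close> by (cases "j = Suc n") auto
qed

lemma poly_eq_const_mult_prod_roots:
  fixes p :: "real poly"
  assumes "finite Z" and "\<And>z. z \<in> Z \<Longrightarrow> poly p z = 0" and "degree p \<le> card Z"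
  shows "\<exists>c. \<forall>x. poly p x = c * (\<Prod>z\<in>Z. x - z)"
proof -
  define q where "q = (\<Prod>z\<in>Z. [:- z, 1:])"
  have "q dvd p"
    unfolding q_def using assms(1,2)
  proof (induction Z arbitrary: p rule: finite_induct)
    case (insert z Z)
    then obtain r where r: "p = [:- z, 1:] * r" by (metis dvdE poly_eq_0_iff_dvd insertI1)
    have "poly r y = 0" if "y \<in> Z" for y
    proof -
      have "y \<noteq> z" "poly p y = 0" using insert that by auto
      then show ?thesis using r by simp
    qed
    then have "(\<Prod>z\<in>Z. [:- z, 1:]) dvd r" using insert.IH by blast
    then show ?case unfolding prod.insert[OF insert.hyps] r by (rule mult_dvd_mono[OF dvd_refl])
  qed simp
  then obtain r where r: "p = q * r" by (elim dvdE)
  have "q \<noteq> 0" and "degree q = card Z"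
    using assms(1) by (auto simp: q_def degree_prod_eq_sum_degree)
  then have "degree r = 0" using r assms(3) by (cases "r = 0") (auto simp: degree_mult_eq)
  then obtain c where "r = [:c:]" by (elim degree_eq_zeroE)
  then show ?thesis using r by (auto simp: q_def poly_prod mult.commute)
qed

lemma prod_pairs_pos:
  fixes a b :: "'i \<Rightarrow> real"
  assumes "\<And>m. m \<in> S \<Longrightarrow> a m \<le> b m" and "\<And>m. m \<in> S \<Longrightarrow> x \<notin> {a m..b m}"
  shows "0 < (\<Prod>m\<in>S. (x - a m) * (x - b m))"
proof (rule prod_pos)
  fix m assume "m \<in> S"
  then have "\<not> (a m \<le> x \<and> x \<le> b m)" "a m \<le> b m" using assms by auto
  then have "x < a m \<or> b m < x" "a m \<le> b m" by auto
  then show "0 < (x - a m) * (x - b m)" by (auto intro: mult_neg_neg)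
qed

lemma prod_pairs_neg:
  fixes a b :: "'i \<Rightarrow> real"
  assumes "finite S" and "l \<in> S" and "a l < x" "x < b l"
    and "\<And>m. m \<in> S \<Longrightarrow> a m \<le> b m" and "\<And>m. m \<in> S \<Longrightarrow> m \<noteq> l \<Longrightarrow> x \<notin> {a m..b m}"
  shows "(\<Prod>m\<in>S. (x - a m) * (x - b m)) < 0"
proof -
  have "0 < (\<Prod>m\<in>S - {l}. (x - a m) * (x - b m))" using assms by (intro prod_pairs_pos) auto
  moreover have "(x - a l) * (x - b l) < 0" using assms(3,4) by (simp add: mult_pos_neg)
  ultimately show ?thesis using assms(1,2) by (simp add: prod.remove mult_neg_pos)
qed

lemma sum_initial_segment:
  fixes j k :: nat
  assumes "j \<le> k"
  shows "(\<Sum>l=1..k. if l \<le> j then f l else 0) = (\<Sum>l=1..j. f l)"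
proof -
  have "{l\<in>{1..k}. l \<le> j} = {1..j}" using assms by auto
  then show ?thesis by (simp flip: sum.inter_filter)
qed

section \<open>Interpolation at increasing nodes\<close>

locale increasing_nodes =
  fixes k :: nat and \<theta> :: "nat \<Rightarrow> real"
  assumes nodes_increasing: "\<forall>j\<in>{1..<k}. \<theta> j < \<theta> (Suc j)"
begin

lemma strict_mono_on_nodes: "strict_mono_on {1..k} \<theta>"
proof -
  have "\<theta> l < \<theta> m" if "1 \<le> l" "l < m" "m \<le> k" for l m
    using that
  proof (induction m)
    case (Suc m)
    then have "\<theta> m < \<theta> (Suc m)" using nodes_increasing by auto
    then show ?case using Suc by (cases "l = m") auto
  qed simp
  then show ?thesis by (intro strict_mono_onI) auto
qed

lemma nodes_less_iff: "l \<in> {1..k} \<Longrightarrow> m \<in> {1..k} \<Longrightarrow> \<theta> l < \<theta> m \<longleftrightarrow> l < m"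
  using strict_mono_on_less[OF strict_mono_on_nodes] .

lemma nodes_le_iff: "l \<in> {1..k} \<Longrightarrow> m \<in> {1..k} \<Longrightarrow> \<theta> l \<le> \<theta> m \<longleftrightarrow> l \<le> m"
  using nodes_less_iff by (meson not_le)

lemma inj_on_nodes: "inj_on \<theta> {1..k}"
  using strict_mono_on_nodes by (rule strict_mono_on_imp_inj_on)

lemma node_interval_unique:
  assumes "m \<in> {1..<k}" "l \<in> {1..<k}"
    and "\<theta> m \<le> x" "x < \<theta> (Suc m)" "\<theta> l \<le> x" "x < \<theta> (Suc l)"
  shows "l = m"
  using assms nodes_less_iff[of m "Suc l"] nodes_less_iff[of l "Suc m"] by auto

lemma bracket_index_exists: "\<exists>j\<le>k. (j = 0 \<or> \<theta> j \<le> x) \<and> (j = k \<or> x < \<theta> (Suc j))"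
proof -
  define J where "J = {j\<in>{0..k}. j = 0 \<or> \<theta> j \<le> x}"
  have "finite J" "0 \<in> J" by (auto simp: J_def)
  then have j: "Max J \<in> J" "\<And>j. j \<in> J \<Longrightarrow> j \<le> Max J" by (auto intro: Max_in)
  have "Max J = k \<or> x < \<theta> (Suc (Max J))"
  proof (rule ccontr)
    assume "\<not> ?thesis"
    then have "Suc (Max J) \<in> J" using j(1) by (auto simp: J_def)
    then show False using j(2) by fastforce
  qed
  moreover have "Max J \<le> k" "Max J = 0 \<or> \<theta> (Max J) \<le> x" using j(1) by (auto simp: J_def)
  ultimately show ?thesis by blast
qed

definition lagrange :: "nat \<Rightarrow> real poly" where
  "lagrange l = smult (1 / (\<Prod>m\<in>{1..k}-{l}. \<theta> l - \<theta> m)) (\<Prod>m\<in>{1..k}-{l}. [:- \<theta> m, 1:])"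

lemma lagrange_denominator_nonzero:
  assumes l: "l \<in> {1..k}"
  shows "(\<Prod>m\<in>{1..k}-{l}. \<theta> l - \<theta> m) \<noteq> 0"
proof
  assume "(\<Prod>m\<in>{1..k}-{l}. \<theta> l - \<theta> m) = 0"
  then have "\<exists>m\<in>{1..k}-{l}. \<theta> l - \<theta> m = 0" by (simp add: prod_zero_iff)
  then obtain m where "m \<in> {1..k}-{l}" "\<theta> l - \<theta> m = 0" by blast
  then show False using inj_onD[OF inj_on_nodes, of l m] l by simp
qed

lemma poly_lagrange:
  "l \<in> {1..k} \<Longrightarrow> m \<in> {1..k} \<Longrightarrow> poly (lagrange l) (\<theta> m) = (if m = l then 1 else 0)"
  using lagrange_denominator_nonzero[of l] by (auto simp: lagrange_def poly_prod)

lemma lagrange_nonzero: "l \<in> {1..k} \<Longrightarrow> lagrange l \<noteq> 0"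
  using poly_lagrange[of l l] by auto

lemma degree_lagrange: "l \<in> {1..k} \<Longrightarrow> degree (lagrange l) = k - 1"
  using lagrange_denominator_nonzero[of l]
  by (simp add: lagrange_def degree_prod_eq_sum_degree)

lemma degree_lagrange_square: "l \<in> {1..k} \<Longrightarrow> degree ((lagrange l)\<^sup>2) = 2 * k - 2"
  using degree_lagrange[of l] lagrange_nonzero[of l] by (simp add: degree_power_eq)

definition hermite :: "nat \<Rightarrow> real poly" where
  "hermite l = (1 - smult (2 * poly (pderiv (lagrange l)) (\<theta> l)) [:- \<theta> l, 1:]) * (lagrange l)\<^sup>2"

lemma poly_hermite:
  "l \<in> {1..k} \<Longrightarrow> m \<in> {1..k} \<Longrightarrow> poly (hermite l) (\<theta> m) = (if m = l then 1 else 0)"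
  by (simp add: hermite_def poly_lagrange)

lemma poly_pderiv_hermite: "l \<in> {1..k} \<Longrightarrow> m \<in> {1..k} \<Longrightarrow> poly (pderiv (hermite l)) (\<theta> m) = 0"
  unfolding hermite_def poly_pderiv_mult_square
  by (simp add: poly_lagrange pderiv_diff pderiv_smult pderiv_pCons)

lemma degree_hermite: "l \<in> {1..k} \<Longrightarrow> degree (hermite l) \<le> 2 * k - 1"
proof -
  assume l: "l \<in> {1..k}"
  have "degree (hermite l) \<le> 1 + (2 * k - 2)"
    unfolding hermite_def using degree_lagrange_square[OF l]
    by (intro order.trans[OF degree_mult_le] add_mono degree_diff_le) auto
  moreover have "1 + (2 * k - 2) = 2 * k - 1" using l by auto
  ultimately show ?thesis by simp
qed

lemma step_poly_exists:
  assumes i: "i \<in> {1..k}"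
  shows "\<exists>P. degree P \<le> 2 * k - 2 \<and> (\<forall>m\<in>{1..k}. poly P (\<theta> m) = (if m \<le> i then 1 else 0)) \<and>
             (\<forall>m\<in>{1..k}-{i}. poly (pderiv P) (\<theta> m) = 0)"
proof -
  \<comment> \<open>Subtracting a multiple of Q, which vanishes at all nodes and is stationary at all but
      \<open>\<theta> i\<close>, cancels the coefficient of degree \<open>2 * k - 1\<close>.\<close>
  define H where "H = (\<Sum>l=1..i. hermite l)"
  define Q where "Q = [:- \<theta> i, 1:] * (lagrange i)\<^sup>2"
  define P where "P = H - smult (coeff H (Suc (2 * k - 2)) / coeff Q (Suc (2 * k - 2))) Q"
  have k: "Suc (2 * k - 2) = 2 * k - 1" using i by auto
  have "degree H \<le> Suc (2 * k - 2)"
    unfolding H_def k using i by (intro degree_sum_le degree_hermite) auto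
  moreover have "degree Q = Suc (2 * k - 2)"
    unfolding Q_def using i lagrange_nonzero[OF i] degree_lagrange_square[OF i]
    by (subst degree_mult_eq) auto
  ultimately have "degree P \<le> 2 * k - 2" unfolding P_def by (rule degree_cancel_leading_coeff)
  moreover have "poly P (\<theta> m) = (if m \<le> i then 1 else 0)" if m: "m \<in> {1..k}" for m
  proof -
    have "poly H (\<theta> m) = (\<Sum>l=1..i. if m = l then 1 else 0)"
      unfolding H_def poly_sum using i m by (intro sum.cong) (auto simp: poly_hermite)
    then show ?thesis using i m by (simp add: P_def Q_def poly_lagrange)
  qed
  moreover have "poly (pderiv P) (\<theta> m) = 0" if m: "m \<in> {1..k}-{i}" for m
  proof -
    have "poly (pderiv H) (\<theta> m) = 0"
      unfolding H_def pderiv_sum poly_sum using i m by (intro sum.neutral) (auto simp: poly_pderiv_hermite)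
    moreover have "poly (pderiv Q) (\<theta> m) = 0"
      unfolding Q_def poly_pderiv_mult_square using i m by (simp add: poly_lagrange)
    ultimately show ?thesis by (simp add: P_def pderiv_diff pderiv_smult)
  qed
  ultimately show ?thesis by blast
qed

context
  fixes i :: nat and P :: "real poly" and \<xi> :: "nat \<Rightarrow> real"
  assumes i: "1 \<le> i" "i < k"
    and degree_P: "degree P \<le> 2 * k - 2"
    and poly_P: "\<forall>m\<in>{1..k}. poly P (\<theta> m) = (if m \<le> i then 1 else 0)"
    and critical_nodes: "\<forall>m\<in>{1..k}-{i}. poly (pderiv P) (\<theta> m) = 0"
    and critical_gaps: "\<forall>m\<in>{1..<k}-{i}. \<theta> m < \<xi> m \<and> \<xi> m < \<theta> (Suc m) \<and> poly (pderiv P) (\<xi> m) = 0"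
begin

lemma critical_gap_bounds:
  assumes "m \<in> {1..<k}-{i}"
  shows "\<theta> m < \<xi> m" "\<xi> m < \<theta> (Suc m)"
  using critical_gaps assms by auto

lemma critical_gaps_mono:
  assumes "m \<in> {1..<k}-{i}" "l \<in> {1..<k}-{i}" "m < l"
  shows "\<xi> m < \<xi> l"
proof -
  have "\<theta> (Suc m) \<le> \<theta> l" using assms by (subst nodes_le_iff) auto
  moreover have "\<xi> m < \<theta> (Suc m)" "\<theta> l < \<xi> l" using critical_gaps assms(1,2) by auto
  ultimately show ?thesis by linarith
qed

lemma critical_gap_not_node:
  assumes "m \<in> {1..<k}-{i}" "l \<in> {1..k}"
  shows "\<theta> l \<noteq> \<xi> m"
proof
  assume "\<theta> l = \<xi> m"
  then have "\<theta> m < \<theta> l" "\<theta> l < \<theta> (Suc m)" using critical_gaps assms(1) by auto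
  then show False using assms nodes_less_iff[of m l] nodes_less_iff[of l "Suc m"] by auto
qed

lemma outside_other_pairs:
  assumes "m \<in> {1..<k}" "\<theta> m \<le> x" "x < \<theta> (Suc m)" "l \<in> {1..<k}-{i}" "l \<noteq> m"
  shows "x \<notin> {\<theta> l..\<xi> l}"
proof
  assume "x \<in> {\<theta> l..\<xi> l}"
  moreover have "\<xi> l < \<theta> (Suc l)" using critical_gaps assms(4) by auto
  ultimately have "\<theta> l \<le> x" "x < \<theta> (Suc l)" by auto
  then show False using node_interval_unique[of m l x] assms by auto
qed

lemma pderiv_eq_roots_product:
  "\<exists>c. \<forall>x. poly (pderiv P) x = c * (x - \<theta> k) * (\<Prod>m\<in>{1..<k}-{i}. (x - \<theta> m) * (x - \<xi> m))"
proof -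
  define S where "S = {1..<k}-{i}"
  define Z where "Z = \<theta> ` ({1..k}-{i}) \<union> \<xi> ` S"
  have nodes: "{1..k}-{i} = insert k S" and "k \<notin> S" using i by (auto simp: S_def)
  have "inj_on \<xi> S"
  proof (rule linorder_inj_onI')
    fix m l assume "m \<in> S" "l \<in> S" "m < l"
    then have "\<xi> m < \<xi> l" unfolding S_def by (rule critical_gaps_mono)
    then show "\<xi> m \<noteq> \<xi> l" by simp
  qed
  then have inj: "inj_on \<theta> ({1..k}-{i})" "inj_on \<xi> S"
    using inj_on_subset[OF inj_on_nodes] by auto
  have disjoint: "\<theta> ` ({1..k}-{i}) \<inter> \<xi> ` S = {}"
    using critical_gap_not_node unfolding S_def by blast
  have "card Z = 2 * k - 3"
    unfolding Z_def using i inj disjoint by (simp add: card_Un_disjoint card_image S_def)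
  moreover have "finite Z" "\<And>z. z \<in> Z \<Longrightarrow> poly (pderiv P) z = 0"
    using critical_nodes critical_gaps by (auto simp: Z_def S_def)
  moreover have "degree (pderiv P) \<le> 2 * k - 3" using degree_P by (simp add: degree_pderiv)
  ultimately obtain c where c: "\<And>x. poly (pderiv P) x = c * (\<Prod>z\<in>Z. x - z)"
    using poly_eq_const_mult_prod_roots[of Z "pderiv P"] by auto
  have "(\<Prod>z\<in>Z. x - z) = (x - \<theta> k) * (\<Prod>m\<in>S. (x - \<theta> m) * (x - \<xi> m))" for x
  proof -
    have "(\<Prod>z\<in>Z. x - z) = (\<Prod>m\<in>{1..k}-{i}. x - \<theta> m) * (\<Prod>m\<in>S. x - \<xi> m)"
      unfolding Z_def using inj disjoint
      by (simp add: prod.union_disjoint prod.reindex S_def)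
    then show ?thesis unfolding nodes using \<open>k \<notin> S\<close> by (simp add: prod.distrib S_def)
  qed
  then show ?thesis using c by (auto simp: S_def mult.assoc)
qed

lemma pderiv_eq_pos_roots_product:
  "\<exists>c>0. \<forall>x. poly (pderiv P) x = c * (x - \<theta> k) * (\<Prod>m\<in>{1..<k}-{i}. (x - \<theta> m) * (x - \<xi> m))"
proof -
  obtain c where c: "\<And>x. poly (pderiv P) x = c * (x - \<theta> k) * (\<Prod>m\<in>{1..<k}-{i}. (x - \<theta> m) * (x - \<xi> m))"
    using pderiv_eq_roots_product by blast
  \<comment> \<open>On the gap \<open>(\<theta> i, \<theta> (Suc i))\<close>, where P drops from 1 to 0, all other factors have known sign.\<close>
  have gap: "\<theta> i < \<theta> (Suc i)" "\<theta> (Suc i) \<le> \<theta> k" using i by (auto simp: nodes_less_iff nodes_le_iff)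
  obtain x where x: "\<theta> i < x" "x < \<theta> (Suc i)"
    and "poly P (\<theta> (Suc i)) - poly P (\<theta> i) = (\<theta> (Suc i) - \<theta> i) * poly (pderiv P) x"
    using poly_MVT[OF gap(1)] by blast
  moreover have "poly P (\<theta> (Suc i)) = 0" "poly P (\<theta> i) = 1" using poly_P i by auto
  ultimately have "(\<theta> (Suc i) - \<theta> i) * poly (pderiv P) x < 0" by simp
  then have "poly (pderiv P) x < 0" using gap(1) by (simp add: mult_less_0_iff)
  moreover have "0 < (\<Prod>m\<in>{1..<k}-{i}. (x - \<theta> m) * (x - \<xi> m))"
    using outside_other_pairs[of i x] x i
    by (intro prod_pairs_pos less_imp_le[OF critical_gap_bounds(1)]) auto
  ultimately have "0 < c" using c[of x] x gap by (auto simp: mult_less_0_iff)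
  then show ?thesis using c by blast
qed

lemma node_Suc_le_last: "m \<in> {1..<k} \<Longrightarrow> \<theta> (Suc m) \<le> \<theta> k"
  by (subst nodes_le_iff) auto

lemma pderiv_nonpos_outside_pairs:
  assumes "x < \<theta> k" and "\<And>m. m \<in> {1..<k}-{i} \<Longrightarrow> x \<notin> {\<theta> m..\<xi> m}"
  shows "poly (pderiv P) x \<le> 0"
proof -
  obtain c where "0 < c" and c: "\<forall>x. poly (pderiv P) x = c * (x - \<theta> k) * (\<Prod>m\<in>{1..<k}-{i}. (x - \<theta> m) * (x - \<xi> m))"
    using pderiv_eq_pos_roots_product by blast
  have "0 < (\<Prod>m\<in>{1..<k}-{i}. (x - \<theta> m) * (x - \<xi> m))"
    using assms(2) by (intro prod_pairs_pos less_imp_le[OF critical_gap_bounds(1)]) auto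
  moreover have "c * (x - \<theta> k) < 0" using \<open>0 < c\<close> assms(1) by (simp add: mult_pos_neg)
  ultimately show ?thesis using c by (simp add: mult_neg_pos less_imp_le)
qed

lemma pderiv_nonneg_in_pair:
  assumes m: "m \<in> {1..<k}-{i}" and x: "\<theta> m < x" "x < \<xi> m"
  shows "0 \<le> poly (pderiv P) x"
proof -
  obtain c where "0 < c" and c: "\<forall>x. poly (pderiv P) x = c * (x - \<theta> k) * (\<Prod>m\<in>{1..<k}-{i}. (x - \<theta> m) * (x - \<xi> m))"
    using pderiv_eq_pos_roots_product by blast
  have "x < \<theta> (Suc m)" using x critical_gap_bounds[OF m] by simp
  then have "(\<Prod>m\<in>{1..<k}-{i}. (x - \<theta> m) * (x - \<xi> m)) < 0"
    using m x outside_other_pairs[of m x]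
    by (intro prod_pairs_neg less_imp_le[OF critical_gap_bounds(1)]) auto
  moreover have "c * (x - \<theta> k) < 0"
    using \<open>0 < c\<close> \<open>x < \<theta> (Suc m)\<close> node_Suc_le_last[of m] m by (simp add: mult_pos_neg)
  ultimately show ?thesis using c by (simp add: mult_neg_neg less_imp_le)
qed

lemma pderiv_nonneg_right:
  assumes "\<theta> k < x"
  shows "0 \<le> poly (pderiv P) x"
proof -
  obtain c where "0 < c" and c: "\<forall>x. poly (pderiv P) x = c * (x - \<theta> k) * (\<Prod>m\<in>{1..<k}-{i}. (x - \<theta> m) * (x - \<xi> m))"
    using pderiv_eq_pos_roots_product by blast
  have "x \<notin> {\<theta> m..\<xi> m}" if "m \<in> {1..<k}-{i}" for m
    using critical_gap_bounds[OF that] node_Suc_le_last[of m] that assms by auto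
  then have "0 < (\<Prod>m\<in>{1..<k}-{i}. (x - \<theta> m) * (x - \<xi> m))"
    by (intro prod_pairs_pos less_imp_le[OF critical_gap_bounds(1)]) auto
  then show ?thesis using c \<open>0 < c\<close> assms by simp
qed

lemma step_poly_above_gap_node:
  assumes j: "j \<in> {1..<k}" "\<theta> j \<le> t" "t < \<theta> (Suc j)"
  shows "\<exists>m\<in>{1..k}. poly P (\<theta> m) \<le> poly P t \<and> (t \<le> \<theta> i \<longrightarrow> m \<le> i)"
proof (cases "j = i \<or> \<xi> j < t")
  case True
  show ?thesis
  proof (cases "t = \<theta> i")
    case True
    then show ?thesis using i by (intro bexI[of _ i]) auto
  next
    case t: False
    have "poly P (\<theta> (Suc j)) \<le> poly P t"
    proof (rule poly_antimono_on)
      fix x assume x: "t < x" "x < \<theta> (Suc j)"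
      have "x \<notin> {\<theta> l..\<xi> l}" if "l \<in> {1..<k}-{i}" for l
        using True that x j outside_other_pairs[of j x l] by (cases "l = j") auto
      then show "poly (pderiv P) x \<le> 0"
        using x node_Suc_le_last[OF j(1)] by (intro pderiv_nonpos_outside_pairs) auto
    qed (use j in simp)
    moreover have "Suc j \<le> i" if "t \<le> \<theta> i"
    proof -
      have "j \<noteq> i" using True t that j by auto
      then have "\<theta> j < \<theta> i" using True that j critical_gap_bounds[of j] by fastforce
      then show ?thesis using j i nodes_less_iff[of j i] by auto
    qed
    ultimately show ?thesis using j by (intro bexI[of _ "Suc j"]) auto
  qed
next
  case False
  have "poly P (\<theta> j) \<le> poly P t"
    using False j by (intro poly_mono_on pderiv_nonneg_in_pair) auto
  moreover have "t \<le> \<theta> i \<Longrightarrow> j \<le> i" using j i nodes_le_iff[of j i] by auto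
  ultimately show ?thesis using j by auto
qed

lemma step_poly_above_node: "\<exists>m\<in>{1..k}. poly P (\<theta> m) \<le> poly P t \<and> (t \<le> \<theta> i \<longrightarrow> m \<le> i)"
proof -
  obtain j where j: "j \<le> k" "j = 0 \<or> \<theta> j \<le> t" "j = k \<or> t < \<theta> (Suc j)"
    using bracket_index_exists by blast
  consider "j = 0" | "j = k" | "j \<in> {1..<k}" using j(1) i by fastforce
  then show ?thesis
  proof cases
    case 1
    have "poly P (\<theta> 1) \<le> poly P t"
    proof (rule poly_antimono_on)
      fix x assume x: "t < x" "x < \<theta> 1"
      have "x \<notin> {\<theta> m..\<xi> m}" if "m \<in> {1..<k}-{i}" for m
        using that x nodes_le_iff[of 1 m] by fastforce
      then show "poly (pderiv P) x \<le> 0"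
        using x i nodes_le_iff[of 1 k] by (intro pderiv_nonpos_outside_pairs) auto
    qed (use 1 j i in auto)
    then show ?thesis using i by (intro bexI[of _ 1]) auto
  next
    case 2
    have "poly P (\<theta> k) \<le> poly P t" using 2 j i by (intro poly_mono_on pderiv_nonneg_right) auto
    moreover have "\<not> t \<le> \<theta> i" using 2 j i nodes_less_iff[of i k] by auto
    ultimately show ?thesis using i by (intro bexI[of _ k]) auto
  next
    case 3
    then show ?thesis using j by (intro step_poly_above_gap_node) auto
  qed
qed

lemma step_poly_ge_indicator: "(if t \<le> \<theta> i then 1 else 0) \<le> poly P t"
proof -
  obtain m where m: "m \<in> {1..k}" "poly P (\<theta> m) \<le> poly P t" "t \<le> \<theta> i \<longrightarrow> m \<le> i"
    using step_poly_above_node by blast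
  then show ?thesis using poly_P by (auto split: if_splits)
qed

end

lemma step_poly_exists_ge_indicator:
  assumes i: "1 \<le> i" "i < k"
  shows "\<exists>P. degree P \<le> 2 * k - 2 \<and> (\<forall>m\<in>{1..k}. poly P (\<theta> m) = (if m \<le> i then 1 else 0)) \<and>
             (\<forall>t. (if t \<le> \<theta> i then 1 else 0) \<le> poly P t)"
proof -
  obtain P where P: "degree P \<le> 2 * k - 2" "\<forall>m\<in>{1..k}. poly P (\<theta> m) = (if m \<le> i then 1 else 0)"
    "\<forall>m\<in>{1..k}-{i}. poly (pderiv P) (\<theta> m) = 0"
    using step_poly_exists[of i] i by auto
  have "\<exists>\<xi>. \<theta> m < \<xi> \<and> \<xi> < \<theta> (Suc m) \<and> poly (pderiv P) \<xi> = 0" if m: "m \<in> {1..<k}-{i}" for m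
  proof -
    have "\<theta> m < \<theta> (Suc m)" using nodes_increasing m by auto
    moreover have "poly P (\<theta> (Suc m)) = poly P (\<theta> m)" using P(2) m by auto
    ultimately show ?thesis using poly_MVT[of "\<theta> m" "\<theta> (Suc m)" P] by auto
  qed
  then obtain \<xi> where "\<forall>m\<in>{1..<k}-{i}. \<theta> m < \<xi> m \<and> \<xi> m < \<theta> (Suc m) \<and> poly (pderiv P) (\<xi> m) = 0"
    by metis
  then show ?thesis using step_poly_ge_indicator[OF i P] P by blast
qed

lemma atomic_cdf_on_bracket:
  assumes "j \<le> k" "j = 0 \<or> \<theta> j \<le> x" "j = k \<or> x < \<theta> (Suc j)"
  shows "atomic_cdf k \<theta> d x = (\<Sum>l=1..j. d l)"
proof -
  have "atomic_cdf k \<theta> d x = (\<Sum>l\<in>{1..k}. if l \<le> j then d l else 0)"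
    unfolding atomic_cdf_def
  proof (intro sum.cong refl)
    fix l assume l: "l \<in> {1..k}"
    have "\<theta> l \<le> x \<longleftrightarrow> l \<le> j"
    proof
      assume "\<theta> l \<le> x"
      then show "l \<le> j" using assms l nodes_le_iff[of "Suc j" l] by (cases "j = k") auto
    next
      assume "l \<le> j"
      then show "\<theta> l \<le> x" using assms l nodes_le_iff[of l j] by (cases "j = 0") auto
    qed
    then show "d l * (if \<theta> l \<le> x then 1 else 0) = (if l \<le> j then d l else 0)" by simp
  qed
  also have "\<dots> = (\<Sum>l=1..j. d l)"
    using assms(1) by (rule sum_initial_segment)
  finally show ?thesis .
qed

end

section \<open>Chebyshev-Markov-Stieltjes inequalities\<close>

definition discrete_cdf :: "real set \<Rightarrow> (real \<Rightarrow> real) \<Rightarrow> real \<Rightarrow> real" where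
  "discrete_cdf \<Lambda> w x = (\<Sum>y\<in>{y\<in>\<Lambda>. y \<le> x}. w y)"

locale gauss_quadrature = increasing_nodes +
  fixes d :: "nat \<Rightarrow> real" and \<Lambda> :: "real set" and w :: "real \<Rightarrow> real"
  assumes k_pos: "1 \<le> k"
    and weights_pos: "\<forall>j\<in>{1..k}. 0 < d j"
    and finite_support: "finite \<Lambda>"
    and masses_nonneg: "\<forall>y\<in>\<Lambda>. 0 \<le> w y"
    and moments_eq: "\<forall>m<2 * k. (\<Sum>j=1..k. d j * \<theta> j ^ m) = (\<Sum>y\<in>\<Lambda>. w y * y ^ m)"
begin

lemma quadrature_exact:
  assumes "degree p < 2 * k"
  shows "(\<Sum>j=1..k. d j * poly p (\<theta> j)) = (\<Sum>y\<in>\<Lambda>. w y * poly p y)"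
proof -
  have "(\<Sum>j=1..k. d j * poly p (\<theta> j)) = (\<Sum>j=1..k. \<Sum>m\<le>degree p. coeff p m * (d j * \<theta> j ^ m))"
    by (simp add: poly_altdef sum_distrib_left mult_ac)
  also have "\<dots> = (\<Sum>m\<le>degree p. coeff p m * (\<Sum>j=1..k. d j * \<theta> j ^ m))"
    by (subst sum.swap) (simp add: sum_distrib_left)
  also have "\<dots> = (\<Sum>m\<le>degree p. coeff p m * (\<Sum>y\<in>\<Lambda>. w y * y ^ m))"
    using moments_eq assms by (intro sum.cong) auto
  also have "\<dots> = (\<Sum>y\<in>\<Lambda>. w y * poly p y)"
    by (simp add: poly_altdef sum_distrib_left sum.swap[of _ \<Lambda>] mult_ac)
  finally show ?thesis .
qed

lemma total_mass: "(\<Sum>y\<in>\<Lambda>. w y) = (\<Sum>j=1..k. d j)"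
  using quadrature_exact[of 1] k_pos by simp

lemma discrete_cdf_nonneg: "0 \<le> discrete_cdf \<Lambda> w x"
  unfolding discrete_cdf_def using masses_nonneg by (intro sum_nonneg) auto

lemma discrete_cdf_mono: "x \<le> x' \<Longrightarrow> discrete_cdf \<Lambda> w x \<le> discrete_cdf \<Lambda> w x'"
  unfolding discrete_cdf_def using masses_nonneg finite_support by (intro sum_mono2) auto

lemma discrete_cdf_le_total: "discrete_cdf \<Lambda> w x \<le> (\<Sum>j=1..k. d j)"
  unfolding discrete_cdf_def total_mass[symmetric]
  using masses_nonneg finite_support by (intro sum_mono2) auto

lemma linear_nonneg_at_node:
  assumes q: "degree q \<le> 1" "\<forall>y\<in>\<Lambda>. 0 \<le> poly q y" and l: "l \<in> {1..k}"
  shows "0 \<le> poly q (\<theta> l)"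
proof -
  have "degree (q * (lagrange l)\<^sup>2) < 2 * k"
    using degree_mult_le[of q "(lagrange l)\<^sup>2"] degree_lagrange_square[OF l] q(1) l by auto
  then have "(\<Sum>j=1..k. d j * poly (q * (lagrange l)\<^sup>2) (\<theta> j)) = (\<Sum>y\<in>\<Lambda>. w y * poly (q * (lagrange l)\<^sup>2) y)"
    by (rule quadrature_exact)
  moreover have "(\<Sum>j=1..k. d j * poly (q * (lagrange l)\<^sup>2) (\<theta> j)) = (\<Sum>j=1..k. if j = l then d l * poly q (\<theta> l) else 0)"
    using l by (intro sum.cong) (auto simp: poly_lagrange)
  moreover have "0 \<le> (\<Sum>y\<in>\<Lambda>. w y * poly (q * (lagrange l)\<^sup>2) y)"
    using masses_nonneg q(2) by (intro sum_nonneg) simp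
  ultimately have "0 \<le> d l * poly q (\<theta> l)" using l by simp
  moreover have "0 < d l" using weights_pos l by blast
  ultimately show ?thesis by (simp add: zero_le_mult_iff)
qed

lemma nodes_within_bounds:
  assumes "\<Lambda> \<subseteq> {a..b}" and "l \<in> {1..k}"
  shows "a \<le> \<theta> l" "\<theta> l \<le> b"
proof -
  have "0 \<le> poly [:- a, 1:] (\<theta> l)" "0 \<le> poly [:b, - 1:] (\<theta> l)"
    using assms by (intro linear_nonneg_at_node; force)+
  then show "a \<le> \<theta> l" "\<theta> l \<le> b" by auto
qed

lemma padded_nodes_mono:
  assumes "\<Lambda> \<subseteq> {a..b}" "\<theta> 0 = a" "\<theta> (Suc k) = b" "j \<le> k"
  shows "\<theta> j \<le> \<theta> (Suc j)"
proof -
  consider "j = 0" | "j = k" | "j \<in> {1..<k}" using assms(4) by fastforce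
  then show ?thesis
    using nodes_within_bounds[OF assms(1), of 1] nodes_within_bounds[OF assms(1), of k]
      nodes_increasing k_pos assms(2,3) by cases (auto intro: less_imp_le)
qed

lemma padded_weights_nonneg:
  assumes "d 0 = 0" "d (Suc k) = 0" "j \<le> Suc k"
  shows "0 \<le> d j"
proof (cases "j \<in> {1..k}")
  case False
  then have "j = 0 \<or> j = Suc k" using assms(3) by auto
  then show ?thesis using assms by auto
qed (use weights_pos in \<open>auto intro: less_imp_le\<close>)

lemma discrete_cdf_at_node_le:
  assumes i: "i \<in> {1..k}"
  shows "discrete_cdf \<Lambda> w (\<theta> i) \<le> (\<Sum>j=1..i. d j)"
proof (cases "i = k")
  case True
  then show ?thesis using discrete_cdf_le_total by simp
next
  case False
  then obtain P where P: "degree P \<le> 2 * k - 2" "\<forall>m\<in>{1..k}. poly P (\<theta> m) = (if m \<le> i then 1 else 0)"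
    "\<forall>t. (if t \<le> \<theta> i then 1 else 0) \<le> poly P t"
    using step_poly_exists_ge_indicator[of i] i by auto
  have "discrete_cdf \<Lambda> w (\<theta> i) = (\<Sum>y\<in>\<Lambda>. w y * (if y \<le> \<theta> i then 1 else 0))"
    unfolding discrete_cdf_def sum.inter_filter[OF finite_support] by (intro sum.cong) auto
  also have "\<dots> \<le> (\<Sum>y\<in>\<Lambda>. w y * poly P y)"
    using masses_nonneg P(3) by (intro sum_mono mult_left_mono) auto
  also have "\<dots> = (\<Sum>j=1..k. d j * poly P (\<theta> j))"
    using P(1) k_pos by (intro quadrature_exact[symmetric]) linarith
  also have "\<dots> = (\<Sum>j=1..k. if j \<le> i then d j else 0)"
    using P(2) by (intro sum.cong) auto
  also have "\<dots> = (\<Sum>j=1..i. d j)"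
    using i by (intro sum_initial_segment) auto
  finally show ?thesis .
qed

lemma reflected_gauss_quadrature:
  "gauss_quadrature k (\<lambda>j. - \<theta> (k + 1 - j)) (\<lambda>j. d (k + 1 - j)) (uminus ` \<Lambda>) (\<lambda>y. w (- y))"
proof unfold_locales
  show "\<forall>j\<in>{1..<k}. - \<theta> (k + 1 - j) < - \<theta> (k + 1 - Suc j)"
  proof
    fix j assume "j \<in> {1..<k}"
    then have "\<theta> (k + 1 - Suc j) < \<theta> (Suc (k + 1 - Suc j))" "Suc (k + 1 - Suc j) = k + 1 - j"
      using nodes_increasing by auto
    then show "- \<theta> (k + 1 - j) < - \<theta> (k + 1 - Suc j)" by simp
  qed
  show "\<forall>j\<in>{1..k}. 0 < d (k + 1 - j)"
  proof
    fix j assume "j \<in> {1..k}"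
    then have "k + 1 - j \<in> {1..k}" by auto
    then show "0 < d (k + 1 - j)" using weights_pos by blast
  qed
  show "\<forall>m<2 * k. (\<Sum>j=1..k. d (k + 1 - j) * (- \<theta> (k + 1 - j)) ^ m) = (\<Sum>y\<in>uminus ` \<Lambda>. w (- y) * y ^ m)"
  proof (intro allI impI)
    fix m assume m: "m < 2 * k"
    have "(\<Sum>j=1..k. d (k + 1 - j) * (- \<theta> (k + 1 - j)) ^ m) = (\<Sum>j=1..k. d j * (- \<theta> j) ^ m)"
      by (rule sum.atLeastAtMost_rev[of "\<lambda>j. d j * (- \<theta> j) ^ m" 1 k, symmetric])
    also have "\<dots> = (\<Sum>y\<in>\<Lambda>. w y * (- y) ^ m)"
      using quadrature_exact[of "[:0, -1:] ^ m"] m degree_power_le[of "[:0, -1:]" m] by simp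
    also have "\<dots> = (\<Sum>y\<in>uminus ` \<Lambda>. w (- y) * y ^ m)"
      by (simp add: sum.reindex inj_on_def)
    finally show "(\<Sum>j=1..k. d (k + 1 - j) * (- \<theta> (k + 1 - j)) ^ m) = (\<Sum>y\<in>uminus ` \<Lambda>. w (- y) * y ^ m)" .
  qed
qed (use k_pos finite_support masses_nonneg in auto)

lemma tail_mass_le:
  assumes i: "i \<in> {1..k}"
  shows "(\<Sum>y\<in>{y\<in>\<Lambda>. \<theta> i \<le> y}. w y) \<le> (\<Sum>j=i..k. d j)"
proof -
  interpret reflected: gauss_quadrature k "\<lambda>j. - \<theta> (k + 1 - j)" "\<lambda>j. d (k + 1 - j)" "uminus ` \<Lambda>" "\<lambda>y. w (- y)"
    by (rule reflected_gauss_quadrature)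
  have "k + 1 - i \<in> {1..k}" "k + 1 - (k + 1 - i) = i" using i by auto
  then have "discrete_cdf (uminus ` \<Lambda>) (\<lambda>y. w (- y)) (- \<theta> i) \<le> (\<Sum>j=1..k + 1 - i. d (k + 1 - j))"
    using reflected.discrete_cdf_at_node_le[of "k + 1 - i"] by simp
  moreover have "{y\<in>uminus ` \<Lambda>. y \<le> - \<theta> i} = uminus ` {y\<in>\<Lambda>. \<theta> i \<le> y}" by auto
  then have "discrete_cdf (uminus ` \<Lambda>) (\<lambda>y. w (- y)) (- \<theta> i) = (\<Sum>y\<in>{y\<in>\<Lambda>. \<theta> i \<le> y}. w y)"
    by (simp add: discrete_cdf_def sum.reindex inj_on_def)
  moreover have "(\<Sum>j=1..k + 1 - i. d (k + 1 - j)) = (\<Sum>j=i..k. d j)"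
    by (rule sum.reindex_bij_witness[where i="\<lambda>j. k + 1 - j" and j="\<lambda>j. k + 1 - j"]) (use i in auto)
  ultimately show ?thesis by simp
qed

lemma discrete_cdf_ge_before_node:
  assumes i: "i \<in> {1..k}" and x: "\<theta> i \<le> x"
  shows "(\<Sum>j\<in>{1..<i}. d j) \<le> discrete_cdf \<Lambda> w x"
proof -
  have "(\<Sum>y\<in>\<Lambda>. w y) = (\<Sum>y\<in>{y\<in>\<Lambda>. y < \<theta> i}. w y) + (\<Sum>y\<in>{y\<in>\<Lambda>. \<theta> i \<le> y}. w y)"
    using finite_support by (subst sum.union_disjoint[symmetric]) (auto intro: sum.cong)
  moreover have "(\<Sum>y\<in>{y\<in>\<Lambda>. y < \<theta> i}. w y) \<le> discrete_cdf \<Lambda> w x"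
    unfolding discrete_cdf_def using masses_nonneg finite_support x by (intro sum_mono2) auto
  moreover have "(\<Sum>j=1..k. d j) = (\<Sum>j\<in>{1..<i}. d j) + (\<Sum>j=i..k. d j)"
    using i by (subst sum.union_disjoint[symmetric]) (auto intro: sum.cong)
  ultimately show ?thesis using tail_mass_le[OF i] total_mass by linarith
qed

lemma discrete_cdf_diff_le_bracket:
  assumes d0: "d 0 = 0" and dk: "d (Suc k) = 0"
    and j: "j \<le> k" "j = 0 \<or> \<theta> j \<le> x" "j = k \<or> x < \<theta> (Suc j)"
  shows "\<bar>discrete_cdf \<Lambda> w x - atomic_cdf k \<theta> d x\<bar> \<le> max (d j) (d (Suc j))"
proof -
  have G: "atomic_cdf k \<theta> d x = (\<Sum>l=1..j. d l)" using j by (rule atomic_cdf_on_bracket)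
  have "discrete_cdf \<Lambda> w x - (\<Sum>l=1..j. d l) \<le> d (Suc j)"
  proof (cases "j = k")
    case True
    then show ?thesis using discrete_cdf_le_total dk by simp
  next
    case False
    then have "discrete_cdf \<Lambda> w x \<le> discrete_cdf \<Lambda> w (\<theta> (Suc j))"
      using j by (intro discrete_cdf_mono) auto
    also have "\<dots> \<le> (\<Sum>l=1..Suc j. d l)" using False j by (intro discrete_cdf_at_node_le) auto
    finally show ?thesis by simp
  qed
  moreover have "(\<Sum>l=1..j. d l) - discrete_cdf \<Lambda> w x \<le> d j"
  proof (cases "j = 0")
    case True
    then show ?thesis using d0 discrete_cdf_nonneg by simp
  next
    case False
    then have "(\<Sum>l=1..j. d l) = (\<Sum>l\<in>{1..<j}. d l) + d j"
      by (simp add: atLeastLessThanSuc_atLeastAtMost[symmetric] del: atLeastLessThanSuc_atLeastAtMost)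
    then show ?thesis using discrete_cdf_ge_before_node[of j x] False j by simp
  qed
  ultimately show ?thesis unfolding G abs_le_iff by auto
qed

lemma discrete_cdf_diff_le_max_weight:
  assumes d0: "d 0 = 0" and dk: "d (Suc k) = 0"
  shows "\<bar>discrete_cdf \<Lambda> w x - atomic_cdf k \<theta> d x\<bar> \<le> Max (d ` {1..k})"
proof -
  obtain j where j: "j \<le> k" "j = 0 \<or> \<theta> j \<le> x" "j = k \<or> x < \<theta> (Suc j)"
    using bracket_index_exists by blast
  have "d l \<le> Max (d ` {1..k})" if "l \<le> Suc k" for l
  proof (cases "l \<in> {1..k}")
    case False
    then have "l = 0 \<or> l = Suc k" using that by auto
    then have "d l = 0" using d0 dk by auto
    moreover have "d 1 \<le> Max (d ` {1..k})" using k_pos by (intro Max_ge) auto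
    moreover have "0 < d 1" using weights_pos k_pos by auto
    ultimately show ?thesis by linarith
  qed (intro Max_ge; auto)
  then have "max (d j) (d (Suc j)) \<le> Max (d ` {1..k})" using j(1) by simp
  then show ?thesis using discrete_cdf_diff_le_bracket[OF d0 dk j] by linarith
qed

lemma discrete_cdf_diff_le_step:
  assumes \<Lambda>: "\<Lambda> \<subseteq> {a..b}" and \<theta>0: "\<theta> 0 = a" and \<theta>k: "\<theta> (Suc k) = b"
    and d0: "d 0 = 0" and dk: "d (Suc k) = 0"
  shows "\<bar>discrete_cdf \<Lambda> w x - atomic_cdf k \<theta> d x\<bar>
           \<le> (\<Sum>j=0..k. max (d j) (d (Suc j)) * indicator {\<theta> j..<\<theta> (Suc j)} x)"
    (is "_ \<le> ?step")
proof -
  obtain j where j: "j \<le> k" "j = 0 \<or> \<theta> j \<le> x" "j = k \<or> x < \<theta> (Suc j)"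
    using bracket_index_exists by blast
  have "0 \<le> max (d l) (d (Suc l))" if "l \<le> k" for l
    using padded_weights_nonneg[OF d0 dk, of l] that by (simp add: le_max_iff_disj)
  then have terms_nonneg: "\<forall>l\<in>{0..k}. 0 \<le> max (d l) (d (Suc l)) * indicator {\<theta> l..<\<theta> (Suc l)} x"
    by (simp add: indicator_def)
  then have "0 \<le> ?step" by (intro sum_nonneg) auto
  have "\<theta> j \<le> x \<or> x < a" "x < \<theta> (Suc j) \<or> b \<le> x" using j \<theta>0 \<theta>k by auto
  then consider "\<theta> j \<le> x" "x < \<theta> (Suc j)" | "x < a" | "b \<le> x" by linarith
  then show ?thesis
  proof cases
    case 1
    have "\<bar>discrete_cdf \<Lambda> w x - atomic_cdf k \<theta> d x\<bar> \<le> max (d j) (d (Suc j)) * indicator {\<theta> j..<\<theta> (Suc j)} x"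
      using discrete_cdf_diff_le_bracket[OF d0 dk j] 1 by simp
    also have "\<dots> \<le> ?step" using j(1) terms_nonneg by (intro member_le_sum) auto
    finally show ?thesis .
  next
    case 2
    have "discrete_cdf \<Lambda> w x = 0" unfolding discrete_cdf_def using \<Lambda> 2 by (intro sum.neutral) auto
    moreover have "atomic_cdf k \<theta> d x = 0"
      using atomic_cdf_on_bracket[of 0 x d] nodes_within_bounds[OF \<Lambda>, of 1] k_pos 2 by auto
    ultimately show ?thesis using \<open>0 \<le> ?step\<close> by simp
  next
    case 3
    have "discrete_cdf \<Lambda> w x = (\<Sum>y\<in>\<Lambda>. w y)" unfolding discrete_cdf_def using \<Lambda> 3 by (intro sum.cong) auto
    moreover have "atomic_cdf k \<theta> d x = (\<Sum>l=1..k. d l)"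
      using atomic_cdf_on_bracket[of k x d] nodes_within_bounds[OF \<Lambda>, of k] k_pos 3 by auto
    ultimately show ?thesis using \<open>0 \<le> ?step\<close> total_mass by simp
  qed
qed

end

section \<open>Spectral decomposition of a symmetric matrix\<close>

lemma symmetric_matrix_inner:
  fixes A :: "real^'n^'n"
  assumes "transpose A = A"
  shows "(A *v x) \<bullet> y = x \<bullet> (A *v y)"
  by (metis assms dot_lmul_matrix vector_transpose_matrix)

lemma symmetric_eigenvectors_orthogonal:
  fixes A :: "real^'n^'n"
  assumes "transpose A = A" "A *v x = l *\<^sub>R x" "A *v y = m *\<^sub>R y" "l \<noteq> m"
  shows "x \<bullet> y = 0"
proof -
  have "l * (x \<bullet> y) = m * (x \<bullet> y)"
    using symmetric_matrix_inner[OF assms(1), of x y] assms(2,3) by simp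
  then show ?thesis using assms(4) by simp
qed

lemma linear_le_quadratic_eq_0:
  fixes B K :: real
  assumes "\<And>t. 2 * t * B \<le> t\<^sup>2 * K"
  shows "B = 0"
proof -
  define s where "s = \<bar>K\<bar> + 1"
  have "0 < s" "K \<le> s - 1" by (auto simp: s_def)
  have "2 * (B / s) * B \<le> (B / s)\<^sup>2 * K" by (rule assms)
  also have "\<dots> \<le> (B / s)\<^sup>2 * (s - 1)" using \<open>K \<le> s - 1\<close> by (simp add: mult_left_mono)
  finally have "2 * B\<^sup>2 * s \<le> B\<^sup>2 * (s - 1)"
    using \<open>0 < s\<close> by (simp add: power2_eq_square field_simps)
  then have "B\<^sup>2 * (s + 1) \<le> 0" by (simp add: algebra_simps)
  then show ?thesis using \<open>0 < s\<close> by (simp add: mult_le_0_iff)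
qed

lemma rayleigh_maximizer_is_eigenvector:
  fixes A :: "real^'n^'n"
  assumes symm: "transpose A = A" and S: "subspace S" and invariant: "\<forall>x\<in>S. A *v x \<in> S"
    and u: "u \<in> S" "u \<bullet> u = 1"
    and max: "\<And>y. y \<in> S \<Longrightarrow> y \<bullet> (A *v y) \<le> (u \<bullet> (A *v u)) * (y \<bullet> y)"
  shows "A *v u = (u \<bullet> (A *v u)) *\<^sub>R u"
proof -
  define c where "c = u \<bullet> (A *v u)"
  have orth: "w \<bullet> (A *v u) = c * (w \<bullet> u)" if w: "w \<in> S" for w
  proof (rule linear_le_quadratic_eq_0[where K = "c * (w \<bullet> w) - w \<bullet> (A *v w)", THEN eq_iff_diff_eq_0[THEN iffD2]])
    fix t :: real
    have "u + t *\<^sub>R w \<in> S" using S u w by (simp add: subspace_add subspace_scale)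
    from max[OF this] show "2 * t * (w \<bullet> (A *v u) - c * (w \<bullet> u)) \<le> t\<^sup>2 * (c * (w \<bullet> w) - w \<bullet> (A *v w))"
      using u(2) symmetric_matrix_inner[OF symm, of w u]
      by (simp add: c_def matrix_vector_right_distrib matrix_vector_mult_scaleR inner_add_left inner_add_right
          inner_commute power2_eq_square algebra_simps)
  qed
  define r where "r = A *v u - c *\<^sub>R u"
  have "r \<in> S" using S u invariant by (simp add: r_def subspace_diff subspace_scale)
  then have "r \<bullet> r = 0" using orth by (simp add: r_def inner_diff_right)
  then show ?thesis by (simp add: r_def c_def)
qed

lemma symmetric_invariant_subspace_has_eigenvector:
  fixes A :: "real^'n^'n"
  assumes symm: "transpose A = A" and S: "subspace S" and invariant: "\<forall>x\<in>S. A *v x \<in> S"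
    and x: "x \<in> S" "x \<noteq> 0"
  shows "\<exists>u\<in>S. u \<bullet> u = 1 \<and> (\<exists>c. A *v u = c *\<^sub>R u)"
proof -
  define K where "K = S \<inter> sphere 0 1"
  have "compact K" unfolding K_def using compact_Int_closed[OF compact_sphere closed_subspace[OF S]]
    by (simp add: Int_commute)
  moreover have "(1 / norm x) *\<^sub>R x \<in> K" using x S by (auto simp: K_def subspace_scale)
  moreover have "continuous_on K (\<lambda>y. y \<bullet> (A *v y))"
    by (intro continuous_intros linear_continuous_on) (auto intro: bounded_linear_intros)
  ultimately obtain u where u: "u \<in> K" "\<And>y. y \<in> K \<Longrightarrow> y \<bullet> (A *v y) \<le> u \<bullet> (A *v u)"
    using continuous_attains_sup[of K "\<lambda>y. y \<bullet> (A *v y)"] by blast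
  have "u \<in> S" "u \<bullet> u = 1" using u(1) by (auto simp: K_def norm_eq_1)
  moreover have "y \<bullet> (A *v y) \<le> (u \<bullet> (A *v u)) * (y \<bullet> y)" if y: "y \<in> S" for y
  proof (cases "y = 0")
    case False
    have "(1 / norm y) *\<^sub>R y \<in> K" using y False S by (auto simp: K_def subspace_scale)
    from u(2)[OF this] show ?thesis using False
      by (simp add: matrix_vector_mult_scaleR power2_norm_eq_inner[symmetric] divide_le_eq power2_eq_square mult_ac)
  qed (simp add: matrix_vector_mult_0_right)
  ultimately show ?thesis using rayleigh_maximizer_is_eigenvector[OF symm S invariant] by blast
qed

definition eigenvectors :: "real^'n^'n \<Rightarrow> (real^'n) set" where
  "eigenvectors A = {u. \<exists>c. A *v u = c *\<^sub>R u}"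

lemma symmetric_invariant_subspace_in_span_eigenvectors:
  fixes A :: "real^'n^'n"
  assumes symm: "transpose A = A"
  shows "subspace S \<Longrightarrow> \<forall>x\<in>S. A *v x \<in> S \<Longrightarrow> S \<subseteq> span (eigenvectors A)"
proof (induction "dim S" arbitrary: S rule: less_induct)
  case less
  show ?case
  proof (cases "S \<subseteq> {0}")
    case False
    then obtain u c where u: "u \<in> S" "u \<bullet> u = 1" "A *v u = c *\<^sub>R u"
      using symmetric_invariant_subspace_has_eigenvector[OF symm less.prems] by blast
    define S' where "S' = {x\<in>S. x \<bullet> u = 0}"
    have "subspace S'" using less.prems(1) by (auto simp: S'_def subspace_def inner_add_left)
    moreover have "\<forall>x\<in>S'. A *v x \<in> S'"
      using less.prems(2) u(3) symmetric_matrix_inner[OF symm, of _ u] by (simp add: S'_def)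
    moreover have "dim S' < dim S"
    proof (rule dim_psubset)
      have "S' \<subseteq> S" "u \<in> S" "u \<notin> S'" using u by (auto simp: S'_def)
      then have "S' \<subset> S" by blast
      then show "span S' \<subset> span S"
        using \<open>subspace S'\<close> less.prems(1) by (simp add: span_eq_iff[THEN iffD2])
    qed
    ultimately have IH: "S' \<subseteq> span (eigenvectors A)" using less.hyps by blast
    have "u \<in> span (eigenvectors A)" using u(3) by (intro span_base) (auto simp: eigenvectors_def)
    show ?thesis
    proof
      fix x assume x: "x \<in> S"
      have "x - (x \<bullet> u) *\<^sub>R u \<in> S'"
        using x u less.prems(1) by (auto simp: S'_def subspace_diff subspace_scale inner_diff_left)
      then have "(x - (x \<bullet> u) *\<^sub>R u) + (x \<bullet> u) *\<^sub>R u \<in> span (eigenvectors A)"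
        using IH \<open>u \<in> span (eigenvectors A)\<close> by (intro span_add span_scale) auto
      then show "x \<in> span (eigenvectors A)" by simp
    qed
  qed (use span_zero in auto)
qed

lemma matrix_vector_mult_sum: "(A::real^'n^'m) *v (\<Sum>i\<in>I. f i) = (\<Sum>i\<in>I. A *v f i)"
  by (rule real_vector.linear_sum[OF matrix_vector_mul_linear])

lemma eigen_decomposition:
  fixes A :: "real^'n^'n" and v :: "real^'n"
  assumes symm: "transpose A = A"
  obtains \<Lambda> e where "finite \<Lambda>" "\<And>l. l \<in> \<Lambda> \<Longrightarrow> A *v e l = l *\<^sub>R e l \<and> e l \<noteq> 0" "v = (\<Sum>l\<in>\<Lambda>. e l)"
proof -
  have "UNIV \<subseteq> span (eigenvectors A)"
    by (rule symmetric_invariant_subspace_in_span_eigenvectors[OF symm subspace_UNIV]) simp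
  then have "v \<in> span (eigenvectors A)" by blast
  then obtain T r where T: "finite T" "T \<subseteq> eigenvectors A" and v: "v = (\<Sum>u\<in>T. r u *\<^sub>R u)"
    unfolding real_vector.span_explicit by blast
  have "\<forall>u\<in>T. \<exists>c. A *v u = c *\<^sub>R u" using T(2) by (auto simp: eigenvectors_def)
  from bchoice[OF this] obtain eigval where eigval: "\<forall>u\<in>T. A *v u = eigval u *\<^sub>R u" by blast
  define e where "e l = (\<Sum>u\<in>{u\<in>T. eigval u = l}. r u *\<^sub>R u)" for l
  have "A *v e l = l *\<^sub>R e l" for l
    unfolding e_def using eigval
    by (simp add: matrix_vector_mult_sum matrix_vector_mult_scaleR scaleR_sum_right mult.commute)
  moreover have "v = (\<Sum>l\<in>{l\<in>eigval ` T. e l \<noteq> 0}. e l)"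
    unfolding v e_def sum.image_gen[OF T(1), of "\<lambda>u. r u *\<^sub>R u" eigval]
    using T(1) by (intro sum.mono_neutral_right) auto
  ultimately show ?thesis by (intro that[of "{l\<in>eigval ` T. e l \<noteq> 0}" e]) (use T(1) in auto)
qed

lemma eigen_decomposition_inner:
  fixes A :: "real^'n^'n"
  assumes symm: "transpose A = A" and "finite \<Lambda>" and e: "\<And>l. l \<in> \<Lambda> \<Longrightarrow> A *v e l = l *\<^sub>R e l"
    and v: "v = (\<Sum>l\<in>\<Lambda>. e l)" and l: "l \<in> \<Lambda>"
  shows "v \<bullet> e l = e l \<bullet> e l"
proof -
  have "e m \<bullet> e l = 0" if "m \<in> \<Lambda> - {l}" for m
    using that l by (intro symmetric_eigenvectors_orthogonal[OF symm e e]) auto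
  then show ?thesis
    unfolding v inner_sum_left using \<open>finite \<Lambda>\<close> l by (simp add: sum.remove)
qed

lemma eigen_decomposition_power:
  fixes A :: "real^'n^'n"
  assumes e: "\<And>l. l \<in> \<Lambda> \<Longrightarrow> A *v e l = l *\<^sub>R e l" and v: "v = (\<Sum>l\<in>\<Lambda>. e l)"
  shows "((*v) A ^^ m) v = (\<Sum>l\<in>\<Lambda>. l ^ m *\<^sub>R e l)"
proof (induction m)
  case (Suc m)
  then show ?case using e by (simp add: matrix_vector_mult_sum matrix_vector_mult_scaleR mult.commute)
qed (simp add: v)

lemma spec_proj_eqI:
  assumes "w \<in> espace_le A x" and "\<And>u. u \<in> espace_le A x \<Longrightarrow> (v - w) \<bullet> u = 0"
  shows "spec_proj A x v = w"
  unfolding spec_proj_def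
proof (rule the_equality)
  fix q assume q: "q \<in> espace_le A x \<and> (\<forall>u\<in>espace_le A x. (v - q) \<bullet> u = 0)"
  have "w - q \<in> espace_le A x" using assms(1) q unfolding espace_le_def by (intro span_diff) auto
  then have "(v - q) \<bullet> (w - q) = 0" "(v - w) \<bullet> (w - q) = 0" using q assms(2) by auto
  moreover have "(w - q) \<bullet> (w - q) = (v - q) \<bullet> (w - q) - (v - w) \<bullet> (w - q)"
    by (simp add: inner_diff_left)
  ultimately have "(w - q) \<bullet> (w - q) = 0" by simp
  then show "q = w" by simp
qed (use assms in blast)

lemma spec_proj_eigen_decomposition:
  fixes A :: "real^'n^'n"
  assumes symm: "transpose A = A" and "finite \<Lambda>" and e: "\<And>l. l \<in> \<Lambda> \<Longrightarrow> A *v e l = l *\<^sub>R e l"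
    and v: "v = (\<Sum>l\<in>\<Lambda>. e l)"
  shows "spec_proj A x v = (\<Sum>l\<in>{l\<in>\<Lambda>. l \<le> x}. e l)"
proof (rule spec_proj_eqI)
  show "(\<Sum>l\<in>{l\<in>\<Lambda>. l \<le> x}. e l) \<in> espace_le A x"
    unfolding espace_le_def using e by (intro span_sum span_base) (auto simp: eigvecs_le_def)
  have "v = (\<Sum>l\<in>{l\<in>\<Lambda>. l \<le> x}. e l) + (\<Sum>l\<in>{l\<in>\<Lambda>. \<not> l \<le> x}. e l)"
    unfolding v using \<open>finite \<Lambda>\<close> by (subst sum.union_disjoint[symmetric]) (auto intro: sum.cong)
  then have rest: "v - (\<Sum>l\<in>{l\<in>\<Lambda>. l \<le> x}. e l) = (\<Sum>l\<in>{l\<in>\<Lambda>. \<not> l \<le> x}. e l)"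
    by (simp add: algebra_simps)
  fix u assume "u \<in> espace_le A x"
  then have "orthogonal (\<Sum>l\<in>{l\<in>\<Lambda>. \<not> l \<le> x}. e l) u"
    unfolding espace_le_def
  proof (rule orthogonal_to_span)
    fix y assume "y \<in> eigvecs_le A x"
    then obtain c where c: "c \<le> x" "A *v y = c *\<^sub>R y" by (auto simp: eigvecs_le_def)
    have "e l \<bullet> y = 0" if "l \<in> {l\<in>\<Lambda>. \<not> l \<le> x}" for l
      using that c by (intro symmetric_eigenvectors_orthogonal[OF symm e c(2)]) auto
    then show "orthogonal (\<Sum>l\<in>{l\<in>\<Lambda>. \<not> l \<le> x}. e l) y"
      by (simp add: orthogonal_def inner_sum_left)
  qed
  then show "(v - (\<Sum>l\<in>{l\<in>\<Lambda>. l \<le> x}. e l)) \<bullet> u = 0" by (simp add: rest orthogonal_def)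
qed

lemma cesm_eq_discrete_cdf:
  fixes A :: "real^'n^'n"
  assumes symm: "transpose A = A"
    and a_le: "\<And>c u. u \<noteq> 0 \<Longrightarrow> A *v u = c *\<^sub>R u \<Longrightarrow> a \<le> c"
    and b_ge: "\<And>c u. u \<noteq> 0 \<Longrightarrow> A *v u = c *\<^sub>R u \<Longrightarrow> c \<le> b"
  obtains \<Lambda> w where "finite \<Lambda>" "\<Lambda> \<subseteq> {a..b}" "\<forall>y\<in>\<Lambda>. 0 \<le> w y" "cesm A v = discrete_cdf \<Lambda> w"
    "\<forall>m. v \<bullet> (((*v) A ^^ m) v) = (\<Sum>y\<in>\<Lambda>. w y * y ^ m)"
proof -
  obtain \<Lambda> e where \<Lambda>: "finite \<Lambda>" and e: "\<And>l. l \<in> \<Lambda> \<Longrightarrow> A *v e l = l *\<^sub>R e l \<and> e l \<noteq> 0"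
    and v: "v = (\<Sum>l\<in>\<Lambda>. e l)"
    using eigen_decomposition[OF symm, where v = v] by blast
  define w where "w l = e l \<bullet> e l" for l
  have vw: "v \<bullet> e l = w l" if "l \<in> \<Lambda>" for l
    unfolding w_def using eigen_decomposition_inner[OF symm \<Lambda> _ v that] e by blast
  have "\<Lambda> \<subseteq> {a..b}" using e a_le b_ge by fastforce
  moreover have "\<forall>y\<in>\<Lambda>. 0 \<le> w y" by (simp add: w_def)
  moreover have "cesm A v = discrete_cdf \<Lambda> w"
  proof
    fix x
    have proj: "spec_proj A x v = (\<Sum>l\<in>{l\<in>\<Lambda>. l \<le> x}. e l)"
      using e by (intro spec_proj_eigen_decomposition[OF symm \<Lambda> _ v]) auto
    show "cesm A v x = discrete_cdf \<Lambda> w x"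
      unfolding cesm_def discrete_cdf_def proj inner_sum_right using vw by (intro sum.cong) auto
  qed
  moreover have "\<forall>m. v \<bullet> (((*v) A ^^ m) v) = (\<Sum>y\<in>\<Lambda>. w y * y ^ m)"
  proof
    fix m
    have power: "((*v) A ^^ m) v = (\<Sum>l\<in>\<Lambda>. l ^ m *\<^sub>R e l)"
      using e by (intro eigen_decomposition_power[OF _ v]) auto
    show "v \<bullet> (((*v) A ^^ m) v) = (\<Sum>y\<in>\<Lambda>. w y * y ^ m)"
      unfolding power inner_sum_right by (intro sum.cong refl) (simp add: vw mult.commute)
  qed
  ultimately show ?thesis by (rule that[OF \<Lambda>])
qed

lemma cesm_gauss_quadrature_bounds:
  fixes A :: "real^'n^'n"
  assumes symm: "transpose A = A"
    and a_le: "\<And>c u. u \<noteq> 0 \<Longrightarrow> A *v u = c *\<^sub>R u \<Longrightarrow> a \<le> c"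
    and b_ge: "\<And>c u. u \<noteq> 0 \<Longrightarrow> A *v u = c *\<^sub>R u \<Longrightarrow> c \<le> b"
    and k: "1 \<le> k" and gq: "is_gauss_quad k A v \<theta> d"
    and \<theta>0: "\<theta> 0 = a" and \<theta>k: "\<theta> (Suc k) = b" and d0: "d 0 = 0" and dk: "d (Suc k) = 0"
  shows "\<bar>cesm A v x - atomic_cdf k \<theta> d x\<bar> \<le> Max (d ` {1..k})"
    and "\<bar>cesm A v x - atomic_cdf k \<theta> d x\<bar> \<le> (\<Sum>j=0..k. max (d j) (d (Suc j)) * indicator {\<theta> j..<\<theta> (Suc j)} x)"
    and "j \<le> k \<Longrightarrow> \<theta> j \<le> \<theta> (Suc j)"
    and "j \<le> k \<Longrightarrow> 0 \<le> max (d j) (d (Suc j))"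
proof -
  obtain \<Lambda> w where \<Lambda>: "finite \<Lambda>" "\<Lambda> \<subseteq> {a..b}" "\<forall>y\<in>\<Lambda>. 0 \<le> w y" "cesm A v = discrete_cdf \<Lambda> w"
    "\<forall>m. v \<bullet> (((*v) A ^^ m) v) = (\<Sum>y\<in>\<Lambda>. w y * y ^ m)"
    by (rule cesm_eq_discrete_cdf[OF symm a_le b_ge])
  interpret gauss_quadrature k \<theta> d \<Lambda> w
  proof unfold_locales
    show "\<forall>j\<in>{1..<k}. \<theta> j < \<theta> (Suc j)" "\<forall>j\<in>{1..k}. 0 < d j"
      using gq by (simp_all add: is_gauss_quad_def)
    show "\<forall>m<2 * k. (\<Sum>j=1..k. d j * \<theta> j ^ m) = (\<Sum>y\<in>\<Lambda>. w y * y ^ m)"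
      using gq \<Lambda>(5) by (simp add: is_gauss_quad_def)
  qed (use k \<Lambda>(1,3) in auto)
  show "\<bar>cesm A v x - atomic_cdf k \<theta> d x\<bar> \<le> Max (d ` {1..k})"
    using discrete_cdf_diff_le_max_weight[OF d0 dk] \<Lambda>(4) by simp
  show "\<bar>cesm A v x - atomic_cdf k \<theta> d x\<bar> \<le> (\<Sum>j=0..k. max (d j) (d (Suc j)) * indicator {\<theta> j..<\<theta> (Suc j)} x)"
    using discrete_cdf_diff_le_step[OF \<Lambda>(2) \<theta>0 \<theta>k d0 dk] \<Lambda>(4) by simp
  show "j \<le> k \<Longrightarrow> \<theta> j \<le> \<theta> (Suc j)" using padded_nodes_mono[OF \<Lambda>(2) \<theta>0 \<theta>k] by simp
  show "j \<le> k \<Longrightarrow> 0 \<le> max (d j) (d (Suc j))"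
    using padded_weights_nonneg[OF d0 dk, of j] by (simp add: le_max_iff_disj)
qed

section \<open>Distances between averaged distribution functions\<close>

lemma abs_average_diff_le:
  fixes f g :: "nat \<Rightarrow> real" and n :: nat
  shows "\<bar>(\<Sum>i<n. f i) / real n - (\<Sum>i<n. g i) / real n\<bar> \<le> (\<Sum>i<n. \<bar>f i - g i\<bar>) / real n"
proof -
  have "(\<Sum>i<n. f i) / real n - (\<Sum>i<n. g i) / real n = (\<Sum>i<n. f i - g i) / real n"
    by (simp add: sum_subtractf diff_divide_distrib)
  then have "\<bar>(\<Sum>i<n. f i) / real n - (\<Sum>i<n. g i) / real n\<bar> = \<bar>\<Sum>i<n. f i - g i\<bar> / real n"
    by simp
  also have "\<dots> \<le> (\<Sum>i<n. \<bar>f i - g i\<bar>) / real n" by (intro divide_right_mono sum_abs) auto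
  finally show ?thesis .
qed

lemma d_KS_average_le:
  fixes n :: nat
  assumes "\<And>i x. i < n \<Longrightarrow> \<bar>f i x - g i x\<bar> \<le> c i"
  shows "d_KS (\<lambda>x. (\<Sum>i<n. f i x) / real n) (\<lambda>x. (\<Sum>i<n. g i x) / real n) \<le> ereal ((\<Sum>i<n. c i) / real n)"
  unfolding d_KS_def
proof (rule SUP_least)
  fix x
  have "\<bar>(\<Sum>i<n. f i x) / real n - (\<Sum>i<n. g i x) / real n\<bar> \<le> (\<Sum>i<n. \<bar>f i x - g i x\<bar>) / real n"
    by (rule abs_average_diff_le[where f = "\<lambda>i. f i x" and g = "\<lambda>i. g i x"])
  also have "\<dots> \<le> (\<Sum>i<n. c i) / real n" using assms by (intro divide_right_mono sum_mono) auto
  finally show "ereal \<bar>(\<Sum>i<n. f i x) / real n - (\<Sum>i<n. g i x) / real n\<bar> \<le> ereal ((\<Sum>i<n. c i) / real n)"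
    by simp
qed

lemma nn_integral_step_function:
  assumes "finite J" and "\<And>j. j \<in> J \<Longrightarrow> 0 \<le> c j" and "\<And>j. j \<in> J \<Longrightarrow> s j \<le> t j"
  shows "(\<integral>\<^sup>+x. ennreal (\<Sum>j\<in>J. c j * indicator {s j..<t j} x) \<partial>lborel) = ennreal (\<Sum>j\<in>J. c j * (t j - s j))"
proof -
  have "(\<integral>\<^sup>+x. ennreal (\<Sum>j\<in>J. c j * indicator {s j..<t j} x) \<partial>lborel)
      = (\<integral>\<^sup>+x. (\<Sum>j\<in>J. ennreal (c j) * indicator {s j..<t j} x) \<partial>lborel)"
    using assms(2) by (intro nn_integral_cong) (simp add: sum_ennreal[symmetric] ennreal_mult'' ennreal_indicator)
  also have "\<dots> = (\<Sum>j\<in>J. ennreal (c j) * emeasure lborel {s j..<t j})"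
    by (simp add: nn_integral_sum nn_integral_cmult_indicator)
  also have "\<dots> = ennreal (\<Sum>j\<in>J. c j * (t j - s j))"
    using assms(2,3) by (simp add: ennreal_mult sum_ennreal[symmetric])
  finally show ?thesis .
qed

lemma d_W_average_le:
  fixes n :: nat
  assumes bound: "\<And>i x. i < n \<Longrightarrow> \<bar>f i x - g i x\<bar> \<le> (\<Sum>j\<in>J. c i j * indicator {s i j..<t i j} x)"
    and "finite J" and c: "\<And>i j. i < n \<Longrightarrow> j \<in> J \<Longrightarrow> 0 \<le> c i j"
    and st: "\<And>i j. i < n \<Longrightarrow> j \<in> J \<Longrightarrow> s i j \<le> t i j"
  shows "d_W (\<lambda>x. (\<Sum>i<n. f i x) / real n) (\<lambda>x. (\<Sum>i<n. g i x) / real n)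
           \<le> ennreal ((\<Sum>i<n. \<Sum>j\<in>J. c i j * (t i j - s i j)) / real n)"
proof -
  define I where "I = {..<n} \<times> J"
  have step: "(\<Sum>i<n. \<Sum>j\<in>J. h i j) / real n = (\<Sum>p\<in>I. h (fst p) (snd p) / real n)" for h :: "nat \<Rightarrow> _ \<Rightarrow> real"
    by (simp add: I_def sum.cartesian_product sum_divide_distrib case_prod_beta')
  have "\<bar>(\<Sum>i<n. f i x) / real n - (\<Sum>i<n. g i x) / real n\<bar>
      \<le> (\<Sum>p\<in>I. c (fst p) (snd p) / real n * indicator {s (fst p) (snd p)..<t (fst p) (snd p)} x)" for x
  proof -
    have "(\<Sum>i<n. \<bar>f i x - g i x\<bar>) / real n \<le> (\<Sum>i<n. \<Sum>j\<in>J. c i j * indicator {s i j..<t i j} x) / real n"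
      using bound by (intro divide_right_mono sum_mono) auto
    then show ?thesis
      using abs_average_diff_le[where f = "\<lambda>i. f i x" and g = "\<lambda>i. g i x" and n = n] unfolding step by simp
  qed
  then have "d_W (\<lambda>x. (\<Sum>i<n. f i x) / real n) (\<lambda>x. (\<Sum>i<n. g i x) / real n)
      \<le> (\<integral>\<^sup>+x. ennreal (\<Sum>p\<in>I. c (fst p) (snd p) / real n * indicator {s (fst p) (snd p)..<t (fst p) (snd p)} x) \<partial>lborel)"
    unfolding d_W_def by (intro nn_integral_mono ennreal_leI)
  also have "\<dots> = ennreal (\<Sum>p\<in>I. c (fst p) (snd p) / real n * (t (fst p) (snd p) - s (fst p) (snd p)))"
    using \<open>finite J\<close> c st by (intro nn_integral_step_function) (auto simp: I_def)
  finally show ?thesis unfolding step by simp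
qed

theorem theorem3:
  fixes A :: "real^'n^'n" and a b :: real and nv k :: nat
    and V :: "nat \<Rightarrow> real^'n" and \<theta> d :: "nat \<Rightarrow> nat \<Rightarrow> real"
  assumes symm: "transpose A = A"
    and a_le: "\<And>c u. u \<noteq> 0 \<Longrightarrow> A *v u = c *\<^sub>R u \<Longrightarrow> a \<le> c"
    and b_ge: "\<And>c u. u \<noteq> 0 \<Longrightarrow> A *v u = c *\<^sub>R u \<Longrightarrow> c \<le> b"
    and nv: "nv \<ge> 1" and k: "k \<ge> 1"
    and unit: "\<And>i. i < nv \<Longrightarrow> norm (V i) = 1"
    and gq: "\<And>i. i < nv \<Longrightarrow> is_gauss_quad k A (V i) (\<theta> i) (d i)"
    and th0: "\<And>i. \<theta> i 0 = a" and thk: "\<And>i. \<theta> i (k+1) = b"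
    and d0: "\<And>i. d i 0 = 0" and dk: "\<And>i. d i (k+1) = 0"
  shows "d_KS (\<lambda>x. (\<Sum>i<nv. cesm A (V i) x) / real nv)
               (\<lambda>x. (\<Sum>i<nv. atomic_cdf k (\<theta> i) (d i) x) / real nv)
           \<le> ereal ((\<Sum>i<nv. Max (d i ` {1..k})) / real nv) \<and>
         d_W (\<lambda>x. (\<Sum>i<nv. cesm A (V i) x) / real nv)
              (\<lambda>x. (\<Sum>i<nv. atomic_cdf k (\<theta> i) (d i) x) / real nv)
           \<le> ennreal ((\<Sum>i<nv. \<Sum>j=0..k. max (d i j) (d i (j+1)) * (\<theta> i (j+1) - \<theta> i j)) / real nv)"
proof -
  have bounds: "\<bar>cesm A (V i) x - atomic_cdf k (\<theta> i) (d i) x\<bar> \<le> Max (d i ` {1..k})"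
    "\<bar>cesm A (V i) x - atomic_cdf k (\<theta> i) (d i) x\<bar>
       \<le> (\<Sum>j=0..k. max (d i j) (d i (j+1)) * indicator {\<theta> i j..<\<theta> i (j+1)} x)"
    "j \<le> k \<Longrightarrow> \<theta> i j \<le> \<theta> i (j+1)" "j \<le> k \<Longrightarrow> 0 \<le> max (d i j) (d i (j+1))"
    if "i < nv" for i x j
    using cesm_gauss_quadrature_bounds[OF symm a_le b_ge k gq[OF that] th0 _ d0] thk dk by simp_all
  show ?thesis
    by (intro conjI d_KS_average_le d_W_average_le[where c = "\<lambda>i j. max (d i j) (d i (j+1))"
          and s = "\<lambda>i j. \<theta> i j" and t = "\<lambda>i j. \<theta> i (j+1)"]) (use bounds in auto)
qed

end
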